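(* Let $g\in\mathbb R\setminus\{0\}$ and consider the RT algebra associated with the $\mathcal S$-matrix of the $gl(N)$ nonlinear Schrödinger model with defect (see context), with bulk generators $a_\alpha(k),a^\dagger_\alpha(k)$ and defect generators $r_\alpha^\beta(k),t_\alpha^\beta(k)$. For $n\in\mathbb Z_{\ge0}$ put $$H^{(n)}_{RT}=\int_{\mathbb R}dk\,|k|^n\sum_\alpha a^\dagger_\alpha(k)a_\alpha(k).$$ Then these Hamiltonians are in involution and the subalgebra generated by $r(k)$ and $t(k)$ (the defect algebra) is a symmetry algebra of the hierarchy: for all $m,n\in\mathbb Z_{\ge0}$ and $k\in\mathbb R$, $$[H^{(m)}_{RT},H^{(n)}_{RT}]=0,\qquad [H^{(n)}_{RT},t(k)]=0,\qquad [H^{(n)}_{RT},r(k)]=0 .$$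
   Context: Indices $\alpha=(\xi,i)$, $\xi\in\{+,-\}$, $i\in\{1,\dots,N\}$, label a basis of $\mathbb C^2\otimes\mathbb C^N$. $a(k)$ is the column vector $(a_\alpha(k))$, $a^\dagger(k)$ the row vector $(a_\alpha^\dagger(k))$, and $r(k)=(r_\alpha^\beta(k))$, $t(k)=(t_\alpha^\beta(k))$ are matrices of generators. Subscripts $1,2$ denote the copy of $\mathbb C^2\otimes\mathbb C^N$ in which an object lives; $\delta_{12}$ is the identification of copies, so that $(t_1\delta_{12})$ has components $t_\alpha^\beta$. All generators are distributional in $k\in\mathbb R$ and integrals are formal/distributional. With $P_{12}$ the flip on $\mathbb C^N\otimes\mathbb C^N$, put $s_{12}(k)=\dfrac{k\,\mathbb I_N\otimes\mathbb I_N-ig\,P_{12}}{k+ig}$; $\mathcal S_{12}(k_1,k_2)$ is diagonal in the sign indices and equals $s_{12}(\xi_1k_1-\xi_2k_2)$ on the block with signs $(\xi_1,\xi_2)$. It satisfies unitarity $\mathcal S_{12}(k_1,k_2)\mathcal S_{21}(k_2,k_1)=1$ and the Yang–Baxter equation. The RT algebra is the associative unital algebra with these generators and relations - $a_1(k_1)a_2(k_2)=\mathcal S_{21}(k_2,k_1)a_2(k_2)a_1(k_1)$, - $a^\dagger_1(k_1)a^\dagger_2(k_2)=a^\dagger_2(k_2)a^\dagger_1(k_1)\mathcal S_{21}(k_2,k_1)$, - $a_1(k_1)a_2^\dagger(k_2)=a_2^\dagger(k_2)\mathcal S_{12}(k_1,k_2)a_1(k_1)+\delta(k_1-k_2)(\mathbf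 1+t_1(k_1))\delta_{12}+\delta(k_1+k_2)r_1(k_1)\delta_{12}$, - $a_1(k_1)t_2(k_2)=\mathcal S_{21}(k_2,k_1)t_2(k_2)\mathcal S_{12}(k_1,k_2)a_1(k_1)$, - $a_1(k_1)r_2(k_2)=\mathcal S_{21}(k_2,k_1)r_2(k_2)\mathcal S_{12}(k_1,-k_2)a_1(k_1)$, - $t_1(k_1)a_2^\dagger(k_2)=a_2^\dagger(k_2)\mathcal S_{12}(k_1,k_2)t_1(k_1)\mathcal S_{21}(k_2,k_1)$, - $r_1(k_1)a_2^\dagger(k_2)=a_2^\dagger(k_2)\mathcal S_{12}(k_1,k_2)r_1(k_1)\mathcal S_{21}(k_2,-k_1)$, - $\mathcal S_{12}(k_1,k_2)t_1(k_1)\mathcal S_{21}(k_2,k_1)t_2(k_2)=t_2(k_2)\mathcal S_{12}(k_1,k_2)t_1(k_1)\mathcal S_{21}(k_2,k_1)$, - $\mathcal S_{12}(k_1,k_2)t_1(k_1)\mathcal S_{21}(k_2,k_1)r_2(k_2)=r_2(k_2)\mathcal S_{12}(k_1,-k_2)t_1(k_1)\mathcal S_{21}(-k_2,k_1)$, - $\mathcal S_{12}(k_1,k_2)r_1(k_1)\mathcal S_{21}(k_2,-k_1)r_2(k_2)=r_2(k_2)\mathcal S_{12}(k_1,-k_2)r_1(k_1)\mathcal S_{21}(-k_2,-k_1)$, - $t(k)t(k)+r(k)r(-k)=\mathbf 1$ and $t(k)r(k)+r(k)t(-k)=0$. *)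

theory Defs
  imports "HOL-Analysis.Analysis"
begin

text \<open>
  The generators are distributional in the momenta, the relations contain delta functions, and
  the Hamiltonians contain products of fields at coinciding momenta, so the elements of the algebra
  are the formal integrals
  \<open>\<integral> f(p) X\<^sub>1(\<plusminus>p\<^bsub>i1\<^esub>) ... X\<^sub>m(\<plusminus>p\<^bsub>im\<^esub>) dp\<close> over finitely many real momenta \<open>p\<^sub>i\<close>
  with generators \<open>X\<^sub>1, ..., X\<^sub>m\<close>, and all relations are imposed
  under such integrals, inside an arbitrary product.  Smearing \<open>t(k)\<close> with a test function is the
  case of one generator and one momentum.
\<close>

section \<open>Indices, the S-matrix\<close>

datatype sign = Pos | Neg

lemma UNIV_sign: "UNIV = {Pos, Neg}"
  by (auto intro: sign.exhaust)

instance sign :: finite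
  by standard (simp add: UNIV_sign)

primrec sval :: "sign \<Rightarrow> real" where
  "sval Pos = 1"
| "sval Neg = - 1"

text \<open>The range \<open>{1..N}\<close> of the second component is a finite type \<open>'n\<close>.\<close>

type_synonym 'n idx = "sign \<times> 'n"

text \<open>Entries of \<open>s\<^sub>1\<^sub>2(k) = (k - i g P\<^sub>1\<^sub>2) / (k + i g)\<close>: row \<open>(i, j)\<close>, column \<open>(i', j')\<close>.\<close>

definition smat :: "real \<Rightarrow> real \<Rightarrow> 'n \<Rightarrow> 'n \<Rightarrow> 'n \<Rightarrow> 'n \<Rightarrow> complex" where
  "smat g k i j i' j' =
     (of_real k * (if i = i' \<and> j = j' then 1 else 0)
        - \<i> * of_real g * (if i = j' \<and> j = i' then 1 else 0)) / (of_real k + \<i> * of_real g)"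

text \<open>Entries of \<open>S\<^sub>1\<^sub>2(k\<^sub>1, k\<^sub>2)\<close> and \<open>S\<^sub>2\<^sub>1(k\<^sub>2, k\<^sub>1)\<close>: row \<open>(\<alpha>, \<beta>)\<close>, column \<open>(\<gamma>, \<delta>)\<close>, where
  \<open>\<alpha>, \<gamma>\<close> belong to space 1 and \<open>\<beta>, \<delta>\<close> to space 2 in both cases.\<close>

definition S12 :: "real \<Rightarrow> real \<Rightarrow> real \<Rightarrow> 'n idx \<Rightarrow> 'n idx \<Rightarrow> 'n idx \<Rightarrow> 'n idx \<Rightarrow> complex" where
  "S12 g k\<^sub>1 k\<^sub>2 \<alpha> \<beta> \<gamma> \<delta> =
     (if fst \<alpha> = fst \<gamma> \<and> fst \<beta> = fst \<delta>
      then smat g (sval (fst \<alpha>) * k\<^sub>1 - sval (fst \<beta>) * k\<^sub>2) (snd \<alpha>) (snd \<beta>) (snd \<gamma>) (snd \<delta>)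
      else 0)"

definition S21 :: "real \<Rightarrow> real \<Rightarrow> real \<Rightarrow> 'n idx \<Rightarrow> 'n idx \<Rightarrow> 'n idx \<Rightarrow> 'n idx \<Rightarrow> complex" where
  "S21 g k\<^sub>2 k\<^sub>1 \<alpha> \<beta> \<gamma> \<delta> = S12 g k\<^sub>2 k\<^sub>1 \<beta> \<alpha> \<delta> \<gamma>"

section \<open>Words of generators at symbolic momenta\<close>

text \<open>\<open>Ann \<alpha>\<close>, \<open>Cre \<alpha>\<close>, \<open>Refl \<alpha> \<beta>\<close>, \<open>Trans \<alpha> \<beta>\<close> are \<open>a\<^sub>\<alpha>\<close>, \<open>a\<^sup>\<dagger>\<^sub>\<alpha>\<close>, \<open>r\<^sub>\<alpha>\<^sup>\<beta>\<close>, \<open>t\<^sub>\<alpha>\<^sup>\<beta>\<close>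
  (lower index: row, upper index: column).\<close>

datatype 'n gen =
    Ann "'n idx" | Cre "'n idx" | Refl "'n idx" "'n idx" | Trans "'n idx" "'n idx"

text \<open>The argument \<open>(e, i)\<close> of a generator stands for the momentum \<open>e p\<^sub>i\<close>.\<close>

type_synonym marg = "sign \<times> nat"
type_synonym 'n word = "('n gen \<times> marg) list"
type_synonym coeff = "(nat \<Rightarrow> real) \<Rightarrow> complex"

definition val :: "marg \<Rightarrow> (nat \<Rightarrow> real) \<Rightarrow> real" where
  "val x p = sval (fst x) * p (snd x)"

abbreviation mvar :: "nat \<Rightarrow> marg" where
  "mvar i \<equiv> (Pos, i)"

primrec flip :: "sign \<Rightarrow> sign" where
  "flip Pos = Neg"
| "flip Neg = Pos"

definition mneg :: "marg \<Rightarrow> marg" where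
  "mneg x = (flip (fst x), snd x)"

definition margs :: "'n word \<Rightarrow> nat set" where
  "margs w = (snd \<circ> snd) ` set w"

text \<open>The substitution \<open>p\<^sub>i := \<sigma> i\<close> in arguments, words and coefficients.\<close>

definition msub :: "(nat \<Rightarrow> marg) \<Rightarrow> marg \<Rightarrow> marg" where
  "msub \<sigma> x = (case x of (Pos, i) \<Rightarrow> \<sigma> i | (Neg, i) \<Rightarrow> mneg (\<sigma> i))"

definition wsub :: "(nat \<Rightarrow> marg) \<Rightarrow> 'n word \<Rightarrow> 'n word" where
  "wsub \<sigma> w = map (\<lambda>(X, x). (X, msub \<sigma> x)) w"

definition fsub :: "(nat \<Rightarrow> marg) \<Rightarrow> coeff \<Rightarrow> coeff" where
  "fsub \<sigma> f = (\<lambda>p. f (\<lambda>i. val (\<sigma> i) p))"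

section \<open>Admissible formal integrals\<close>

text \<open>The creators (\<open>True\<close>) and annihilators (\<open>False\<close>) with momentum \<open>\<plusminus>p\<^sub>i\<close>, from left to right.\<close>

fun is_cre :: "'n gen \<Rightarrow> bool" where
  "is_cre (Cre _) = True"
| "is_cre _ = False"

fun is_bulk :: "'n gen \<Rightarrow> bool" where
  "is_bulk (Cre _) = True"
| "is_bulk (Ann _) = True"
| "is_bulk _ = False"

definition bulk :: "nat \<Rightarrow> 'n word \<Rightarrow> bool list" where
  "bulk i w = map (\<lambda>(X, x). is_cre X) (filter (\<lambda>(X, x). is_bulk X \<and> snd x = i) w)"

text \<open>
  The integrands for which no \<open>\<delta>(0)\<close> and no divergent integral can occur when the relations are
  applied: a momentum is carried by at most one creator and at most one annihilator, the creator
  standing to the left of the annihilator if both are present, as in \<open>H\<^sup>(\<^sup>n\<^sup>)\<close>; in all momenta not of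
  the latter kind the coefficient has compact support.  The class is closed under products and
  under all relations below.
\<close>

definition admissible :: "nat set \<Rightarrow> coeff \<Rightarrow> 'n word \<Rightarrow> bool" where
  "admissible V f w \<longleftrightarrow>
     finite V \<and> margs w \<subseteq> V \<and>
     (\<forall>p q. (\<forall>i\<in>V. p i = q i) \<longrightarrow> f p = f q) \<and>
     continuous_on UNIV f \<and>
     (\<forall>i. bulk i w \<in> {[], [True], [False], [True, False]}) \<and>
     (\<exists>C. \<forall>i\<in>V. bulk i w \<noteq> [True, False] \<longrightarrow> (\<forall>p. \<bar>p i\<bar> > C \<longrightarrow> f p = 0))"

section \<open>The RT algebra\<close>

text \<open>
  \<open>J V f w\<close> is the formal integral of \<open>f(p) w(p)\<close> over the momenta \<open>p\<^sub>i\<close>, \<open>i \<in> V\<close>.  Its values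
  on inadmissible data are unconstrained.
  In \<open>rel_ac\<close> the momentum of the creator is an integration variable \<open>c\<close>, which the delta functions
  eliminate by \<open>p\<^sub>c := \<plusminus>x\<close>; admissibility excludes that \<open>x\<close> is \<open>\<plusminus>p\<^sub>c\<close>.  A creator at \<open>-p\<^sub>c\<close>
  is covered through \<open>change_vars\<close>.
\<close>

locale RT_algebra = vector_space scale
  for scale :: "complex \<Rightarrow> 'a \<Rightarrow> 'a::ring_1" +
  fixes g :: real
    and J :: "nat set \<Rightarrow> coeff \<Rightarrow> 'n::finite word \<Rightarrow> 'a"
  assumes scale_mult_left: "scale z A * B = scale z (A * B)"
    and scale_mult_right: "A * scale z B = scale z (A * B)"

    and J_add: "admissible V f w \<Longrightarrow> admissible V h w \<Longrightarrow>
      J V (\<lambda>p. f p + h p) w = J V f w + J V h w"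
    and J_scale: "admissible V f w \<Longrightarrow> J V (\<lambda>p. z * f p) w = scale z (J V f w)"
    and J_one: "J {} (\<lambda>p. 1) [] = 1"
    and J_mult: "admissible V f w \<Longrightarrow> admissible V' f' w' \<Longrightarrow> V \<inter> V' = {} \<Longrightarrow>
      J V f w * J V' f' w' = J (V \<union> V') (\<lambda>p. f p * f' p) (w @ w')"
    and change_vars: "admissible V f w \<Longrightarrow> inj_on (snd \<circ> \<sigma>) V \<Longrightarrow>
      J V f w = J ((snd \<circ> \<sigma>) ` V) (fsub \<sigma> f) (wsub \<sigma> w)"
    and integrate_out: "admissible V f w \<Longrightarrow> c \<in> V \<Longrightarrow> c \<notin> margs w \<Longrightarrow>
      J V f w = J (V - {c}) (\<lambda>p. LINT x|lborel. f (p(c := x))) w"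

    and rel_aa: "admissible V f (u @ [(Ann \<alpha>, x), (Ann \<beta>, y)] @ v) \<Longrightarrow>
      J V f (u @ [(Ann \<alpha>, x), (Ann \<beta>, y)] @ v) =
      (\<Sum>\<gamma>\<in>UNIV. \<Sum>\<delta>\<in>UNIV. J V (\<lambda>p. f p * S21 g (val y p) (val x p) \<alpha> \<beta> \<gamma> \<delta>)
         (u @ [(Ann \<delta>, y), (Ann \<gamma>, x)] @ v))"
    and rel_cc: "admissible V f (u @ [(Cre \<alpha>, x), (Cre \<beta>, y)] @ v) \<Longrightarrow>
      J V f (u @ [(Cre \<alpha>, x), (Cre \<beta>, y)] @ v) =
      (\<Sum>\<gamma>\<in>UNIV. \<Sum>\<delta>\<in>UNIV. J V (\<lambda>p. f p * S21 g (val y p) (val x p) \<gamma> \<delta> \<alpha> \<beta>)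
         (u @ [(Cre \<delta>, y), (Cre \<gamma>, x)] @ v))"
    and rel_ac: "admissible V f (u @ [(Ann \<alpha>, x), (Cre \<beta>, mvar c)] @ v) \<Longrightarrow>
      J V f (u @ [(Ann \<alpha>, x), (Cre \<beta>, mvar c)] @ v) =
      (\<Sum>\<gamma>\<in>UNIV. \<Sum>\<delta>\<in>UNIV. J V (\<lambda>p. f p * S12 g (val x p) (p c) \<alpha> \<delta> \<gamma> \<beta>)
         (u @ [(Cre \<delta>, mvar c), (Ann \<gamma>, x)] @ v))
      + (let \<sigma> = mvar(c := x) in
           (if \<alpha> = \<beta> then J (V - {c}) (fsub \<sigma> f) (wsub \<sigma> u @ wsub \<sigma> v) else 0)
           + J (V - {c}) (fsub \<sigma> f) (wsub \<sigma> u @ [(Trans \<alpha> \<beta>, x)] @ wsub \<sigma> v))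
      + (let \<sigma> = mvar(c := mneg x) in
           J (V - {c}) (fsub \<sigma> f) (wsub \<sigma> u @ [(Refl \<alpha> \<beta>, x)] @ wsub \<sigma> v))"
    and rel_at: "admissible V f (u @ [(Ann \<alpha>, x), (Trans \<beta> \<delta>, y)] @ v) \<Longrightarrow>
      J V f (u @ [(Ann \<alpha>, x), (Trans \<beta> \<delta>, y)] @ v) =
      (\<Sum>\<gamma>\<in>UNIV. \<Sum>\<epsilon>\<in>UNIV. \<Sum>\<phi>\<in>UNIV. \<Sum>\<eta>\<in>UNIV.
         J V (\<lambda>p. f p * S21 g (val y p) (val x p) \<alpha> \<beta> \<gamma> \<epsilon> * S12 g (val x p) (val y p) \<gamma> \<phi> \<eta> \<delta>)
           (u @ [(Trans \<epsilon> \<phi>, y), (Ann \<eta>, x)] @ v))"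
    and rel_ar: "admissible V f (u @ [(Ann \<alpha>, x), (Refl \<beta> \<delta>, y)] @ v) \<Longrightarrow>
      J V f (u @ [(Ann \<alpha>, x), (Refl \<beta> \<delta>, y)] @ v) =
      (\<Sum>\<gamma>\<in>UNIV. \<Sum>\<epsilon>\<in>UNIV. \<Sum>\<phi>\<in>UNIV. \<Sum>\<eta>\<in>UNIV.
         J V (\<lambda>p. f p * S21 g (val y p) (val x p) \<alpha> \<beta> \<gamma> \<epsilon> * S12 g (val x p) (- val y p) \<gamma> \<phi> \<eta> \<delta>)
           (u @ [(Refl \<epsilon> \<phi>, y), (Ann \<eta>, x)] @ v))"
    and rel_tc: "admissible V f (u @ [(Trans \<alpha> \<beta>, x), (Cre \<gamma>, y)] @ v) \<Longrightarrow>
      J V f (u @ [(Trans \<alpha> \<beta>, x), (Cre \<gamma>, y)] @ v) =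
      (\<Sum>\<delta>\<in>UNIV. \<Sum>\<epsilon>\<in>UNIV. \<Sum>\<phi>\<in>UNIV. \<Sum>\<eta>\<in>UNIV.
         J V (\<lambda>p. f p * S12 g (val x p) (val y p) \<alpha> \<delta> \<epsilon> \<phi> * S21 g (val y p) (val x p) \<eta> \<phi> \<beta> \<gamma>)
           (u @ [(Cre \<delta>, y), (Trans \<epsilon> \<eta>, x)] @ v))"
    and rel_rc: "admissible V f (u @ [(Refl \<alpha> \<beta>, x), (Cre \<gamma>, y)] @ v) \<Longrightarrow>
      J V f (u @ [(Refl \<alpha> \<beta>, x), (Cre \<gamma>, y)] @ v) =
      (\<Sum>\<delta>\<in>UNIV. \<Sum>\<epsilon>\<in>UNIV. \<Sum>\<phi>\<in>UNIV. \<Sum>\<eta>\<in>UNIV.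
         J V (\<lambda>p. f p * S12 g (val x p) (val y p) \<alpha> \<delta> \<epsilon> \<phi> * S21 g (val y p) (- val x p) \<eta> \<phi> \<beta> \<gamma>)
           (u @ [(Cre \<delta>, y), (Refl \<epsilon> \<eta>, x)] @ v))"
    and rel_tt: "admissible V f (u @ [(Trans \<alpha> \<gamma>, x), (Trans \<beta> \<delta>, y)] @ v) \<Longrightarrow>
      (\<Sum>\<epsilon>\<in>UNIV. \<Sum>\<phi>\<in>UNIV. \<Sum>\<eta>\<in>UNIV. \<Sum>\<theta>\<in>UNIV.
         J V (\<lambda>p. f p * S12 g (val x p) (val y p) \<alpha> \<beta> \<epsilon> \<phi> * S21 g (val y p) (val x p) \<eta> \<phi> \<gamma> \<theta>)
           (u @ [(Trans \<epsilon> \<eta>, x), (Trans \<theta> \<delta>, y)] @ v)) =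
      (\<Sum>\<epsilon>\<in>UNIV. \<Sum>\<phi>\<in>UNIV. \<Sum>\<eta>\<in>UNIV. \<Sum>\<theta>\<in>UNIV.
         J V (\<lambda>p. f p * S12 g (val x p) (val y p) \<alpha> \<phi> \<epsilon> \<theta> * S21 g (val y p) (val x p) \<eta> \<theta> \<gamma> \<delta>)
           (u @ [(Trans \<beta> \<phi>, y), (Trans \<epsilon> \<eta>, x)] @ v))"
    and rel_tr: "admissible V f (u @ [(Trans \<alpha> \<gamma>, x), (Refl \<beta> \<delta>, y)] @ v) \<Longrightarrow>
      (\<Sum>\<epsilon>\<in>UNIV. \<Sum>\<phi>\<in>UNIV. \<Sum>\<eta>\<in>UNIV. \<Sum>\<theta>\<in>UNIV.
         J V (\<lambda>p. f p * S12 g (val x p) (val y p) \<alpha> \<beta> \<epsilon> \<phi> * S21 g (val y p) (val x p) \<eta> \<phi> \<gamma> \<theta>)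
           (u @ [(Trans \<epsilon> \<eta>, x), (Refl \<theta> \<delta>, y)] @ v)) =
      (\<Sum>\<epsilon>\<in>UNIV. \<Sum>\<phi>\<in>UNIV. \<Sum>\<eta>\<in>UNIV. \<Sum>\<theta>\<in>UNIV.
         J V (\<lambda>p. f p * S12 g (val x p) (- val y p) \<alpha> \<phi> \<epsilon> \<theta> * S21 g (- val y p) (val x p) \<eta> \<theta> \<gamma> \<delta>)
           (u @ [(Refl \<beta> \<phi>, y), (Trans \<epsilon> \<eta>, x)] @ v))"
    and rel_rr: "admissible V f (u @ [(Refl \<alpha> \<gamma>, x), (Refl \<beta> \<delta>, y)] @ v) \<Longrightarrow>
      (\<Sum>\<epsilon>\<in>UNIV. \<Sum>\<phi>\<in>UNIV. \<Sum>\<eta>\<in>UNIV. \<Sum>\<theta>\<in>UNIV.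
         J V (\<lambda>p. f p * S12 g (val x p) (val y p) \<alpha> \<beta> \<epsilon> \<phi> * S21 g (val y p) (- val x p) \<eta> \<phi> \<gamma> \<theta>)
           (u @ [(Refl \<epsilon> \<eta>, x), (Refl \<theta> \<delta>, y)] @ v)) =
      (\<Sum>\<epsilon>\<in>UNIV. \<Sum>\<phi>\<in>UNIV. \<Sum>\<eta>\<in>UNIV. \<Sum>\<theta>\<in>UNIV.
         J V (\<lambda>p. f p * S12 g (val x p) (- val y p) \<alpha> \<phi> \<epsilon> \<theta> * S21 g (- val y p) (- val x p) \<eta> \<theta> \<gamma> \<delta>)
           (u @ [(Refl \<beta> \<phi>, y), (Refl \<epsilon> \<eta>, x)] @ v))"
    and rel_unitarity: "admissible V f (u @ v) \<Longrightarrow> snd x \<in> V \<Longrightarrow>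
      (\<Sum>\<gamma>\<in>UNIV. J V f (u @ [(Trans \<alpha> \<gamma>, x), (Trans \<gamma> \<beta>, x)] @ v)
             + J V f (u @ [(Refl \<alpha> \<gamma>, x), (Refl \<gamma> \<beta>, mneg x)] @ v)) =
      (if \<alpha> = \<beta> then J V f (u @ v) else 0)"
    and rel_tr_rt: "admissible V f (u @ v) \<Longrightarrow> snd x \<in> V \<Longrightarrow>
      (\<Sum>\<gamma>\<in>UNIV. J V f (u @ [(Trans \<alpha> \<gamma>, x), (Refl \<gamma> \<beta>, x)] @ v)
             + J V f (u @ [(Refl \<alpha> \<gamma>, x), (Trans \<gamma> \<beta>, mneg x)] @ v)) = 0"

section \<open>Hamiltonians, smeared defect generators, defect algebra\<close>

definition H_RT :: "(nat set \<Rightarrow> coeff \<Rightarrow> 'n::finite word \<Rightarrow> 'a::ring_1) \<Rightarrow> nat \<Rightarrow> 'a" where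
  "H_RT J n = (\<Sum>\<alpha>\<in>UNIV. J {0} (\<lambda>p. of_real (\<bar>p 0\<bar> ^ n)) [(Cre \<alpha>, mvar 0), (Ann \<alpha>, mvar 0)])"

definition test_function :: "(real \<Rightarrow> complex) \<Rightarrow> bool" where
  "test_function \<phi> \<longleftrightarrow> continuous_on UNIV \<phi> \<and> (\<exists>C. \<forall>k. \<bar>k\<bar> > C \<longrightarrow> \<phi> k = 0)"

definition smeared ::
  "(nat set \<Rightarrow> coeff \<Rightarrow> 'n word \<Rightarrow> 'a) \<Rightarrow> 'n gen \<Rightarrow> (real \<Rightarrow> complex) \<Rightarrow> 'a" where
  "smeared J X \<phi> = J {0} (\<lambda>p. \<phi> (p 0)) [(X, mvar 0)]"

text \<open>The subalgebra generated by \<open>r\<close> and \<open>t\<close>; as the algebra contains formal integrals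
  over several momenta, so do its generators here.\<close>

inductive_set defect_algebra ::
  "(complex \<Rightarrow> 'a \<Rightarrow> 'a::ring_1) \<Rightarrow> (nat set \<Rightarrow> coeff \<Rightarrow> 'n::finite word \<Rightarrow> 'a) \<Rightarrow> 'a set"
  for scale :: "complex \<Rightarrow> 'a \<Rightarrow> 'a::ring_1"
    and J :: "nat set \<Rightarrow> coeff \<Rightarrow> 'n::finite word \<Rightarrow> 'a" where
  gen: "admissible V f w \<Longrightarrow> (\<forall>X\<in>fst ` set w. \<not> is_bulk X) \<Longrightarrow> J V f w \<in> defect_algebra scale J"
| one: "1 \<in> defect_algebra scale J"
| add: "x \<in> defect_algebra scale J \<Longrightarrow> y \<in> defect_algebra scale J \<Longrightarrow>
    x + y \<in> defect_algebra scale J"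
| mult: "x \<in> defect_algebra scale J \<Longrightarrow> y \<in> defect_algebra scale J \<Longrightarrow>
    x * y \<in> defect_algebra scale J"
| scale: "x \<in> defect_algebra scale J \<Longrightarrow> scale c x \<in> defect_algebra scale J"

definition commutator :: "'a::ring_1 \<Rightarrow> 'a \<Rightarrow> 'a" where
  "commutator x y = x * y - y * x"

end

theory Submission
  imports Defs
begin

text \<open>
  Commuting the density \<open>\<Sum>\<^sub>\<alpha> a\<^sup>\<dagger>\<^sub>\<alpha>(p) a\<^sub>\<alpha>(p)\<close> past a defect generator, by moving
  \<open>a\<close> to the right on one side and \<open>a\<^sup>\<dagger>\<close> to the left on the other, gives the same
  sum of normal ordered words with the same coefficients, so no property of the S-matrix
  besides continuity is needed.  In the product of two Hamiltonians the contact terms created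
  by the delta functions depend only on \<open>|p|\<^bsup>m+n\<^esup>\<close> and cancel in the commutator; the remaining
  quartic terms of the two orders agree after exchanging the two creators in one
  of them and the two annihilators in the other.
\<close>

section \<open>Admissible integrands\<close>

lemma bulk_simps [simp]:
  "bulk i [] = []"
  "bulk i ((X, x) # w) = (if is_bulk X \<and> snd x = i then is_cre X # bulk i w else bulk i w)"
  "bulk i (u @ v) = bulk i u @ bulk i v"
  by (auto simp: bulk_def)

lemma margs_simps [simp]:
  "margs [] = {}"
  "margs ((X, x) # w) = insert (snd x) (margs w)"
  "margs (u @ v) = margs u \<union> margs v"
  by (auto simp: margs_def)

text \<open>The conditions of \<open>admissible\<close> on the coefficient that do not mention the
  word, isolated because they are stable under products.\<close>

definition local_coeff :: "nat set \<Rightarrow> coeff \<Rightarrow> bool" where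
  "local_coeff V h \<longleftrightarrow>
     (\<forall>p q. (\<forall>i\<in>V. p i = q i) \<longrightarrow> h p = h q) \<and> continuous_on UNIV h"

lemma local_coeff_mult:
  assumes "local_coeff V f" "local_coeff V h"
  shows "local_coeff V (\<lambda>p. f p * h p)"
  using assms unfolding local_coeff_def by (metis continuous_on_mult)

lemma continuous_on_val [continuous_intros]: "continuous_on A (val x)"
  unfolding val_def
  by (intro continuous_intros continuous_on_subset[OF continuous_on_product_coordinates]) auto

lemma local_coeff_power_abs:
  "c \<in> V \<Longrightarrow> local_coeff V (\<lambda>p. of_real (\<bar>p c\<bar> ^ n))"
  unfolding local_coeff_def
  by (auto intro!: continuous_intros continuous_on_product_coordinates)

text \<open>At real momenta the denominator of \<open>smat\<close> has imaginary part
  \<open>g\<close>, so it never vanishes. The hypothesis \<open>g \<noteq> 0\<close> enters the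
  development through this fact alone.\<close>

lemma continuous_on_S12:
  assumes "g \<noteq> 0" "continuous_on A k" "continuous_on A l"
  shows "continuous_on A (\<lambda>p. S12 g (k p) (l p) \<alpha> \<beta> \<gamma> \<delta>)"
proof -
  have nz: "of_real t + \<i> * of_real g \<noteq> 0" for t
    using assms(1) by (auto simp: complex_eq_iff)
  show ?thesis
  proof (cases "fst \<alpha> = fst \<gamma> \<and> fst \<beta> = fst \<delta>")
    case True
    then show ?thesis
      unfolding S12_def smat_def
      by (simp only: simp_thms if_True) (intro continuous_intros assms ballI nz)
  next
    case False
    then show ?thesis unfolding S12_def by (simp only: if_False continuous_on_const)
  qed
qed

lemma local_coeff_S12:
  assumes "g \<noteq> 0" "snd x \<in> V" "snd y \<in> V"
  shows "local_coeff V (\<lambda>p. S12 g (val x p) (val y p) \<alpha> \<beta> \<gamma> \<delta>)"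
  unfolding local_coeff_def
proof (intro conjI allI impI)
  show "S12 g (val x p) (val y p) \<alpha> \<beta> \<gamma> \<delta> = S12 g (val x q) (val y q) \<alpha> \<beta> \<gamma> \<delta>"
    if "\<forall>i\<in>V. p i = q i" for p q
    using that assms by (simp add: val_def)
qed (intro continuous_on_S12 continuous_on_val assms)

text \<open>Admissibility sees a word only through its momenta and the creator-annihilator pattern
  at each of them, so defect generators may be moved freely.\<close>

lemma admissible_word:
  assumes "admissible V f w" "\<And>i. bulk i w' = bulk i w" "margs w' \<subseteq> V"
  shows "admissible V f w'"
  using assms unfolding admissible_def by auto

text \<open>The support condition is vacuous when every momentum carries a creator followed by an
  annihilator; this admits the growing coefficients of the Hamiltonians.\<close>

lemma admissible_paired:
  assumes "finite V" "local_coeff V f" "margs w \<subseteq> V"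
    and "\<And>i. i \<in> V \<Longrightarrow> bulk i w = [True, False]"
    and "\<And>i. i \<notin> V \<Longrightarrow> bulk i w = []"
  shows "admissible V f w"
  using assms unfolding admissible_def local_coeff_def by (metis insertCI)

text \<open>\<open>J_mult\<close> equates integrals without asserting that the combined data are
  admissible, which the exchange relations demand.\<close>

lemma admissible_density_mult:
  assumes f: "admissible V f w" and c: "c \<notin> V"
  shows "admissible (insert c V) (\<lambda>p. f p * of_real (\<bar>p c\<bar> ^ n))
           ([(Cre \<alpha>, mvar c), (Ann \<alpha>, mvar c)] @ w)"
proof -
  have m: "margs w \<subseteq> V" using f by (simp add: admissible_def)
  then have b: "bulk c w = []"
    using c by (force simp: bulk_def filter_empty_conv margs_def)
  have f': "local_coeff (insert c V) f"
    using f by (auto simp: admissible_def local_coeff_def)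
  have l: "local_coeff (insert c V) (\<lambda>p. f p * of_real (\<bar>p c\<bar> ^ n))"
    by (intro local_coeff_mult f' local_coeff_power_abs) simp
  have b': "bulk i ([(Cre \<alpha>, mvar c), (Ann \<alpha>, mvar c)] @ w) =
      (if i = c then [True, False] else bulk i w)" for i
    using b by simp
  \<comment> \<open>The old bound still serves: \<open>c\<close> carries a pair and is exempt, and
    at the other momenta the factor \<open>f p\<close> already vanishes beyond
    \<open>C\<close>.\<close>
  obtain C where "\<forall>i\<in>V. bulk i w \<noteq> [True, False] \<longrightarrow> (\<forall>p. \<bar>p i\<bar> > C \<longrightarrow> f p = 0)"
    using f unfolding admissible_def by blast
  then have "\<exists>C. \<forall>i\<in>insert c V.
      bulk i ([(Cre \<alpha>, mvar c), (Ann \<alpha>, mvar c)] @ w) \<noteq> [True, False] \<longrightarrow>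
      (\<forall>p. \<bar>p i\<bar> > C \<longrightarrow> f p * of_real (\<bar>p c\<bar> ^ n) = 0)"
    unfolding b' by (intro exI[of _ C]) auto
  moreover have "\<forall>i. bulk i ([(Cre \<alpha>, mvar c), (Ann \<alpha>, mvar c)] @ w)
      \<in> {[], [True], [False], [True, False]}"
    unfolding b' using f by (auto simp: admissible_def)
  moreover have "finite (insert c V)" "margs ([(Cre \<alpha>, mvar c), (Ann \<alpha>, mvar c)] @ w) \<subseteq> insert c V"
    using f m by (auto simp: admissible_def)
  ultimately show ?thesis
    using l unfolding admissible_def local_coeff_def by blast
qed

section \<open>Commutation with the defect generators\<close>

text \<open>The index sets are distinct variables so that rewriting with \<open>sum.swap\<close> at
  one of them moves just that sum inwards; all are \<open>UNIV\<close> in the application.\<close>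

lemma sum_rotate5:
  "(\<Sum>a\<in>A. \<Sum>g\<in>G. \<Sum>e\<in>E. \<Sum>h\<in>H. \<Sum>z\<in>Z. F a g e h z) =
   (\<Sum>z\<in>Z. \<Sum>a\<in>A. \<Sum>e\<in>E. \<Sum>g\<in>G. \<Sum>h\<in>H. F a g e h z)"
proof -
  have "(\<Sum>z\<in>Z. \<Sum>a\<in>A. \<Sum>e\<in>E. \<Sum>g\<in>G. \<Sum>h\<in>H. F a g e h z) =
      (\<Sum>a\<in>A. \<Sum>e\<in>E. \<Sum>g\<in>G. \<Sum>h\<in>H. \<Sum>z\<in>Z. F a g e h z)"
    by (simp only: sum.swap[where A = Z])
  also have "\<dots> = (\<Sum>a\<in>A. \<Sum>g\<in>G. \<Sum>e\<in>E. \<Sum>h\<in>H. \<Sum>z\<in>Z. F a g e h z)"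
    by (intro sum.cong refl sum.swap)
  finally show ?thesis by simp
qed

lemma sum_reorder6:
  "(\<Sum>a\<in>A. \<Sum>b\<in>B. \<Sum>c\<in>C. \<Sum>d\<in>D. \<Sum>e\<in>E. \<Sum>f\<in>H. F a b c d e f) =
   (\<Sum>f\<in>H. \<Sum>a\<in>A. \<Sum>d\<in>D. \<Sum>e\<in>E. \<Sum>b\<in>B. \<Sum>c\<in>C. F a b c d e f)"
proof -
  have "(\<Sum>f\<in>H. \<Sum>a\<in>A. \<Sum>d\<in>D. \<Sum>e\<in>E. \<Sum>b\<in>B. \<Sum>c\<in>C. F a b c d e f) =
      (\<Sum>a\<in>A. \<Sum>d\<in>D. \<Sum>e\<in>E. \<Sum>b\<in>B. \<Sum>c\<in>C. \<Sum>f\<in>H. F a b c d e f)"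
    by (simp only: sum.swap[where A = H])
  also have "\<dots> = (\<Sum>a\<in>A. \<Sum>d\<in>D. \<Sum>b\<in>B. \<Sum>c\<in>C. \<Sum>e\<in>E. \<Sum>f\<in>H. F a b c d e f)"
    by (simp only: sum.swap[where A = E])
  also have "\<dots> = (\<Sum>a\<in>A. \<Sum>b\<in>B. \<Sum>c\<in>C. \<Sum>d\<in>D. \<Sum>e\<in>E. \<Sum>f\<in>H. F a b c d e f)"
    by (simp only: sum.swap[where A = D])
  finally show ?thesis by simp
qed

context RT_algebra
begin

text \<open>Both sides expand into words creator, \<open>X\<close>, annihilator. Once
  \<open>S21\<close> is written as \<open>S12\<close>, the two coefficients are the same product of
  entries up to renaming of indices; for reflection, the sign change of the momentum of
  \<open>X\<close> falls on the same factor.\<close>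

lemma density_defect_swap:
  assumes X: "\<not> is_bulk X"
    and adm: "\<And>\<alpha>. admissible V f (u @ [(Cre \<alpha>, mvar c), (Ann \<alpha>, mvar c)] @ (X, y) # v)"
  shows "(\<Sum>\<alpha>\<in>UNIV. J V f (u @ [(Cre \<alpha>, mvar c), (Ann \<alpha>, mvar c)] @ (X, y) # v)) =
    (\<Sum>\<alpha>\<in>UNIV. J V f (u @ (X, y) # [(Cre \<alpha>, mvar c), (Ann \<alpha>, mvar c)] @ v))"
proof -
  have adm': "admissible V f (u @ [(X, y), (Cre \<alpha>, mvar c)] @ (Ann \<alpha>, mvar c) # v)" for \<alpha>
    by (rule admissible_word[OF adm]) (use X adm in \<open>auto simp: admissible_def\<close>)
  have adm'': "admissible V f ((u @ [(Cre \<alpha>, mvar c)]) @ [(Ann \<alpha>, mvar c), (X, y)] @ v)" for \<alpha>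
    using adm[of \<alpha>] by simp
  show ?thesis
  proof (cases X)
    case (Trans \<beta> \<delta>)
    show ?thesis
      using rel_at[OF adm''[unfolded Trans]] rel_tc[OF adm'[unfolded Trans]]
      by (simp add: Trans S21_def) (rule sum_rotate5)
  next
    case (Refl \<beta> \<delta>)
    show ?thesis
      using rel_ar[OF adm''[unfolded Refl]] rel_rc[OF adm'[unfolded Refl]]
      by (simp add: Refl S21_def) (rule sum_rotate5)
  qed (use X in auto)
qed

lemma density_defect_word_swap:
  assumes "\<forall>X\<in>fst ` set v. \<not> is_bulk X"
    and "\<And>\<alpha>. admissible V f (u @ [(Cre \<alpha>, mvar c), (Ann \<alpha>, mvar c)] @ v)"
  shows "(\<Sum>\<alpha>\<in>UNIV. J V f (u @ [(Cre \<alpha>, mvar c), (Ann \<alpha>, mvar c)] @ v)) =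
    (\<Sum>\<alpha>\<in>UNIV. J V f (u @ v @ [(Cre \<alpha>, mvar c), (Ann \<alpha>, mvar c)]))"
  using assms
proof (induction v arbitrary: u)
  case (Cons a v)
  obtain X y where a: "a = (X, y)" by (cases a)
  have X: "\<not> is_bulk X" using Cons.prems a by auto
  note adm = Cons.prems(2)[unfolded a]
  \<comment> \<open>The generator just passed joins the prefix, which is why the induction
    generalises \<open>u\<close>.\<close>
  have "admissible V f ((u @ [(X, y)]) @ [(Cre \<alpha>, mvar c), (Ann \<alpha>, mvar c)] @ v)" for \<alpha>
    by (rule admissible_word[OF adm]) (use X adm in \<open>auto simp: admissible_def\<close>)
  then show ?case
    using density_defect_swap[OF X adm] Cons.IH[of "u @ [(X, y)]"] Cons.prems(1)
    by (simp add: a)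
qed simp

lemma admissible_density:
  "admissible {c} (\<lambda>p. of_real (\<bar>p c\<bar> ^ n)) [(Cre \<alpha>, mvar c), (Ann \<alpha>, mvar c)]"
  by (rule admissible_paired) (auto intro: local_coeff_power_abs simp del: of_real_power)

lemma H_RT_at:
  "H_RT J n = (\<Sum>\<alpha>\<in>UNIV. J {c} (\<lambda>p. of_real (\<bar>p c\<bar> ^ n)) [(Cre \<alpha>, mvar c), (Ann \<alpha>, mvar c)])"
proof -
  have "J {0} (\<lambda>p. of_real (\<bar>p 0\<bar> ^ n)) [(Cre \<alpha>, mvar 0), (Ann \<alpha>, mvar 0)] =
      J {c} (\<lambda>p. of_real (\<bar>p c\<bar> ^ n)) [(Cre \<alpha>, mvar c), (Ann \<alpha>, mvar c)]" for \<alpha>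
    \<comment> \<open>A constant substitution is injective on the single momentum
      \<open>0\<close>.\<close>
    using change_vars[OF admissible_density[of 0 n \<alpha>], of "\<lambda>_. mvar c"]
    by (simp add: fsub_def wsub_def msub_def val_def)
  then show ?thesis by (simp add: H_RT_def)
qed

lemma H_RT_commutes_defect_word:
  assumes adm: "admissible V f w" and w: "\<forall>X\<in>fst ` set w. \<not> is_bulk X"
  shows "H_RT J n * J V f w = J V f w * H_RT J n"
proof -
  \<comment> \<open>The Hamiltonian is rewritten at a fresh momentum, since \<open>J_mult\<close>
    needs disjoint variables.\<close>
  obtain c where c: "c \<notin> V"
    using adm ex_new_if_finite[OF infinite_UNIV_nat] unfolding admissible_def by metis
  have "H_RT J n * J V f w = (\<Sum>\<alpha>\<in>UNIV. J (insert c V) (\<lambda>p. f p * of_real (\<bar>p c\<bar> ^ n))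
      ([] @ [(Cre \<alpha>, mvar c), (Ann \<alpha>, mvar c)] @ w))"
    using J_mult[OF admissible_density adm] c
    by (simp add: H_RT_at[of n c] sum_distrib_right mult.commute)
  also have "\<dots> = (\<Sum>\<alpha>\<in>UNIV. J (insert c V) (\<lambda>p. f p * of_real (\<bar>p c\<bar> ^ n))
      ([] @ w @ [(Cre \<alpha>, mvar c), (Ann \<alpha>, mvar c)]))"
    using density_defect_word_swap[OF w, where u = "[]"] admissible_density_mult[OF adm c] by simp
  also have "\<dots> = J V f w * H_RT J n"
    using J_mult[OF adm admissible_density] c
    by (simp add: H_RT_at[of n c] sum_distrib_left)
  finally show ?thesis .
qed

lemma H_RT_commutes_defect_algebra:
  assumes "x \<in> defect_algebra scale J"
  shows "H_RT J n * x = x * H_RT J n"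
  using assms
proof induction
  case (gen V f w)
  then show ?case by (rule H_RT_commutes_defect_word)
next
  case (mult x y)
  then show ?case by (metis mult.assoc)
qed (auto simp: distrib_left distrib_right scale_mult_left scale_mult_right)

text \<open>A lone defect generator leaves its momentum unpaired, so the compact support of the test
  function is what makes the integrand admissible.\<close>

lemma smeared_in_defect_algebra:
  assumes "test_function \<phi>" "\<not> is_bulk X"
  shows "smeared J X \<phi> \<in> defect_algebra scale J"
proof -
  have "continuous_on UNIV (\<lambda>p::nat \<Rightarrow> real. \<phi> (p 0))"
    using assms(1) by (auto simp: test_function_def intro: continuous_on_compose2
        continuous_on_product_coordinates)
  then have "admissible {0} (\<lambda>p. \<phi> (p 0)) [(X, mvar 0)]"
    using assms by (auto simp: admissible_def test_function_def)
  then show ?thesis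
    unfolding smeared_def by (rule defect_algebra.gen) (use assms in simp)
qed

section \<open>Involution\<close>

text \<open>The normal ordered four-field part of the product of two Hamiltonians, with the fields
  in the order that \<open>rel_ac\<close> produces.\<close>

definition quartic :: "nat \<Rightarrow> nat \<Rightarrow> nat \<Rightarrow> nat \<Rightarrow> 'a" where
  "quartic c d m n = (\<Sum>\<alpha>\<in>UNIV. \<Sum>\<beta>\<in>UNIV. \<Sum>\<gamma>\<in>UNIV. \<Sum>\<delta>\<in>UNIV.
     J {c, d} (\<lambda>p. of_real (\<bar>p c\<bar> ^ m) * of_real (\<bar>p d\<bar> ^ n) * S12 g (p c) (p d) \<alpha> \<delta> \<gamma> \<beta>)
       [(Cre \<alpha>, mvar c), (Cre \<delta>, mvar d), (Ann \<gamma>, mvar c), (Ann \<beta>, mvar d)])"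

text \<open>The three terms left by the delta functions: identity, transmission and reflection. In
  the last one the eliminated momentum is \<open>-p c\<close>, hence the annihilator at
  \<open>(Neg, c)\<close>.\<close>

definition contact :: "nat \<Rightarrow> 'n idx \<Rightarrow> 'n idx \<Rightarrow> nat \<Rightarrow> 'a" where
  "contact c \<alpha> \<beta> n =
     (if \<alpha> = \<beta> then J {c} (\<lambda>p. of_real (\<bar>p c\<bar> ^ n)) [(Cre \<alpha>, mvar c), (Ann \<beta>, mvar c)] else 0)
     + J {c} (\<lambda>p. of_real (\<bar>p c\<bar> ^ n)) [(Cre \<alpha>, mvar c), (Trans \<alpha> \<beta>, mvar c), (Ann \<beta>, mvar c)]
     + J {c} (\<lambda>p. of_real (\<bar>p c\<bar> ^ n))
         [(Cre \<alpha>, mvar c), (Refl \<alpha> \<beta>, mvar c), (Ann \<beta>, (Neg, c))]"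

lemma contact_at: "contact c \<alpha> \<beta> n = contact d \<alpha> \<beta> n"
proof -
  have "J {c} (\<lambda>p. of_real (\<bar>p c\<bar> ^ n)) w =
      J {d} (\<lambda>p. of_real (\<bar>p d\<bar> ^ n)) (wsub (\<lambda>_. mvar d) w)"
    if "admissible {c} (\<lambda>p. of_real (\<bar>p c\<bar> ^ n)) w" for w
    using change_vars[OF that, of "\<lambda>_. mvar d"] by (simp add: fsub_def val_def)
  moreover have "admissible {c} (\<lambda>p. of_real (\<bar>p c\<bar> ^ n)) w"
    if "w \<in> {[(Cre \<alpha>, mvar c), (Ann \<beta>, mvar c)],
        [(Cre \<alpha>, mvar c), (Trans \<alpha> \<beta>, mvar c), (Ann \<beta>, mvar c)],
        [(Cre \<alpha>, mvar c), (Refl \<alpha> \<beta>, mvar c), (Ann \<beta>, (Neg, c))]}" for w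
    using that by (intro admissible_paired) (auto intro: local_coeff_power_abs simp del: of_real_power)
  ultimately show ?thesis
    by (simp add: contact_def wsub_def msub_def mneg_def)
qed

text \<open>Only the inner pair, the annihilator at \<open>c\<close> and the creator at
  \<open>d\<close>, is out of normal order. Both delta functions set \<open>p d\<close> to
  \<open>p c\<close> up to sign, and the absolute values turn the coefficient into the power
  \<open>m + n\<close> in either case.\<close>

lemma H_RT_mult:
  assumes "c \<noteq> d"
  shows "H_RT J m * H_RT J n =
    quartic c d m n + (\<Sum>\<alpha>\<in>UNIV. \<Sum>\<beta>\<in>UNIV. contact c \<alpha> \<beta> (m + n))"
proof -
  let ?f = "\<lambda>p. of_real (\<bar>p c\<bar> ^ m) * of_real (\<bar>p d\<bar> ^ n) :: complex"
  have "J {c} (\<lambda>p. of_real (\<bar>p c\<bar> ^ m)) [(Cre \<alpha>, mvar c), (Ann \<alpha>, mvar c)] *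
      J {d} (\<lambda>p. of_real (\<bar>p d\<bar> ^ n)) [(Cre \<beta>, mvar d), (Ann \<beta>, mvar d)] =
      (\<Sum>\<gamma>\<in>UNIV. \<Sum>\<delta>\<in>UNIV. J {c, d} (\<lambda>p. ?f p * S12 g (p c) (p d) \<alpha> \<delta> \<gamma> \<beta>)
       [(Cre \<alpha>, mvar c), (Cre \<delta>, mvar d), (Ann \<gamma>, mvar c), (Ann \<beta>, mvar d)]) +
      contact c \<alpha> \<beta> (m + n)" for \<alpha> \<beta>
  proof -
    have "admissible {c, d} ?f
        ([(Cre \<alpha>, mvar c)] @ [(Ann \<alpha>, mvar c), (Cre \<beta>, mvar d)] @ [(Ann \<beta>, mvar d)])"
      using assms by (intro admissible_paired local_coeff_mult local_coeff_power_abs) auto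
    note rel_ac[OF this]
    moreover have "{c, d} - {d} = {c}" using assms by auto
    moreover have "J {c} (\<lambda>p. of_real (\<bar>p c\<bar> ^ m)) [(Cre \<alpha>, mvar c), (Ann \<alpha>, mvar c)] *
      J {d} (\<lambda>p. of_real (\<bar>p d\<bar> ^ n)) [(Cre \<beta>, mvar d), (Ann \<beta>, mvar d)] =
      J {c, d} ?f [(Cre \<alpha>, mvar c), (Ann \<alpha>, mvar c), (Cre \<beta>, mvar d), (Ann \<beta>, mvar d)]"
      using J_mult[OF admissible_density[of c m \<alpha>] admissible_density[of d n \<beta>]] assms
      by (simp add: insert_commute)
    ultimately show ?thesis
      using assms
      by (simp add: contact_def Let_def fsub_def wsub_def msub_def val_def mneg_def power_add
          add.assoc)
  qed
  then show ?thesis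
    by (simp add: H_RT_at[of m c] H_RT_at[of n d] sum_product quartic_def sum.distrib)
qed

text \<open>Exchanging the creators on the left and the annihilators on the right leads to the
  common words in \<open>?F\<close>, each with one S-matrix entry from normal ordering and one from
  the exchange.\<close>

lemma quartic_sym:
  assumes g: "g \<noteq> 0" and cd: "c \<noteq> d"
  shows "quartic c d m n = quartic d c n m"
proof -
  let ?f = "\<lambda>p. of_real (\<bar>p c\<bar> ^ m) * of_real (\<bar>p d\<bar> ^ n) :: complex"
  let ?F = "\<lambda>\<delta>' \<gamma>' \<delta> \<alpha> \<gamma> \<beta>. J {c, d} (\<lambda>p. ?f p * (S12 g (p d) (p c) \<delta>' \<gamma>' \<delta> \<alpha> *
      S12 g (p c) (p d) \<alpha> \<delta> \<gamma> \<beta>))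
      [(Cre \<delta>', mvar d), (Cre \<gamma>', mvar c), (Ann \<gamma>, mvar c), (Ann \<beta>, mvar d)]"
  \<comment> \<open>The exchanges act on integrands that already contain an S-matrix entry, so its
    continuity is needed for admissibility.\<close>
  have S: "local_coeff {c, d} (\<lambda>p. S12 g (p c) (p d) \<alpha> \<beta> \<gamma> \<delta>)"
    "local_coeff {c, d} (\<lambda>p. S12 g (p d) (p c) \<alpha> \<beta> \<gamma> \<delta>)" for \<alpha> \<beta> \<gamma> \<delta>
    using local_coeff_S12[OF g, of "mvar c" "{c, d}" "mvar d" \<alpha> \<beta> \<gamma> \<delta>]
      local_coeff_S12[OF g, of "mvar d" "{c, d}" "mvar c" \<alpha> \<beta> \<gamma> \<delta>] by (simp_all add: val_def)
  have "quartic c d m n = (\<Sum>\<alpha>\<in>UNIV. \<Sum>\<beta>\<in>UNIV. \<Sum>\<gamma>\<in>UNIV. \<Sum>\<delta>\<in>UNIV. \<Sum>\<gamma>'\<in>UNIV. \<Sum>\<delta>'\<in>UNIV.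
      ?F \<delta>' \<gamma>' \<delta> \<alpha> \<gamma> \<beta>)"
  proof -
    have "admissible {c, d} (\<lambda>p. ?f p * S12 g (p c) (p d) \<alpha> \<delta> \<gamma> \<beta>)
      ([] @ [(Cre \<alpha>, mvar c), (Cre \<delta>, mvar d)] @ [(Ann \<gamma>, mvar c), (Ann \<beta>, mvar d)])"
      for \<alpha> \<beta> \<gamma> \<delta>
      using cd by (intro admissible_paired local_coeff_mult local_coeff_power_abs S) auto
    from rel_cc[OF this] show ?thesis
      by (simp add: quartic_def S21_def val_def ac_simps)
  qed
  also have "\<dots> = (\<Sum>\<delta>'\<in>UNIV. \<Sum>\<alpha>\<in>UNIV. \<Sum>\<delta>\<in>UNIV. \<Sum>\<gamma>'\<in>UNIV. \<Sum>\<beta>\<in>UNIV. \<Sum>\<gamma>\<in>UNIV.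
      ?F \<delta>' \<gamma>' \<delta> \<alpha> \<gamma> \<beta>)"
    by (rule sum_reorder6)
  also have "\<dots> = quartic d c n m"
  proof -
    have "admissible {c, d} (\<lambda>p. ?f p * S12 g (p d) (p c) \<alpha> \<delta> \<gamma> \<beta>)
      ([(Cre \<alpha>, mvar d), (Cre \<delta>, mvar c)] @ [(Ann \<gamma>, mvar d), (Ann \<beta>, mvar c)] @ [])"
      for \<alpha> \<beta> \<gamma> \<delta>
      using cd by (intro admissible_paired local_coeff_mult local_coeff_power_abs S) auto
    from rel_aa[OF this] show ?thesis
      by (simp add: quartic_def S21_def val_def ac_simps insert_commute)
  qed
  finally show ?thesis .
qed

end

theorem mainTheorem2:
  fixes scale :: "complex \<Rightarrow> 'a::ring_1 \<Rightarrow> 'a"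
    and g :: real
    and J :: "nat set \<Rightarrow> coeff \<Rightarrow> 'n::finite word \<Rightarrow> 'a"
  assumes "g \<noteq> 0"
    and "RT_algebra scale g J"
  shows "(\<forall>m n. commutator (H_RT J m) (H_RT J n) = 0) \<and>
    (\<forall>n \<alpha> \<beta> \<phi>. test_function \<phi> \<longrightarrow> commutator (H_RT J n) (smeared J (Trans \<alpha> \<beta>) \<phi>) = 0) \<and>
    (\<forall>n \<alpha> \<beta> \<phi>. test_function \<phi> \<longrightarrow> commutator (H_RT J n) (smeared J (Refl \<alpha> \<beta>) \<phi>) = 0) \<and>
    (\<forall>n. \<forall>x \<in> defect_algebra scale J. commutator (H_RT J n) x = 0)"
proof -
  interpret RT_algebra scale g J by fact
  have "H_RT J m * H_RT J n = H_RT J n * H_RT J m" for m n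
    \<comment> \<open>Swapping momenta along with exponents keeps the power \<open>m\<close> on
      momentum \<open>0\<close> in both products, as \<open>quartic_sym\<close> requires;
      \<open>contact_at\<close> then brings the contact terms to a common momentum.\<close>
    using H_RT_mult[of 0 1 m n] H_RT_mult[of 1 0 n m] quartic_sym[OF assms(1), of 0 1 m n]
      contact_at[of 1 _ _ _ 0]
    by (simp add: add.commute)
  then show ?thesis
    using H_RT_commutes_defect_algebra smeared_in_defect_algebra
    by (auto simp: commutator_def)
qed

end
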